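(* Run the sequential dual (SD) algorithm (defined in the context) for $N\ge 1$ iterations with the stepsizes $$\sigma=M_{T}\frac{\Omega_X}{\Omega_{\Pi}},\qquad \tau=M_{T}M_{\Pi}C_p\frac{\Omega_X}{\Omega_P},\qquad \eta=M_{T}M_{\Pi}C_p\frac{\Omega_P}{\Omega_X}+M_{T}\frac{\Omega_{\Pi}}{\Omega_X}.$$ Then the averaged point $\bar x_N=\frac1N\sum_{t=1}^N x_t$ satisfies $$f(\bar x_N)-f(x^* )\le \frac{2\,\Omega_X M_{T}}{N}\bigl(\Omega_{\Pi}+C_p M_{\Pi}\Omega_P\bigr).$$
   Context: Problem. $X\subset\mathbb{R}^n$ is nonempty, convex and compact; $P\subset\mathbb{R}^K$ is a nonempty convex compact set of probability vectors ($p_k\ge0$, $\sum_k p_k=1$); $f_0:X\to\mathbb{R}$ is closed convex and Lipschitz continuous; $\phi^*:P\to\mathbb{R}$ is closed and convex; for $k=1,\dots,K$, $T_k\in\mathbb{R}^{m_k\times n}$ and $g_k:\mathbb{R}^{m_k}\to\mathbb{R}$ is convex and Lipschitz continuous, with Fenchel conjugate $g_k^*$. Put $\Pi(k)=\{\pi_k: g_k^*(\pi_k)<\infty\}$ (a bounded set), $\Pi=\Pi(1)\times\cdots\times\Pi(K)$, $\pi=(\pi_1,\dots,\pi_K)$. The objective is $$f(x)=f_0(x)+\max_{p\in P}\Bigl\{\sum_{k=1}^K p_k g_k(T_kx)-\phi^*(p)\Bigr\},\quad x\in X,$$ and $x^*$ is a minimizer of $f$ over $X$. Norms and distances. $V(x,x')=\frac12\|x-x'\|_2^2$;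 $U(\pi_k,\pi_k')=\frac12\|\pi_k-\pi_k'\|_2^2$. $\|\cdot\|_W$ is a norm on $\mathbb{R}^K$ with dual norm $\|\cdot\|_{W^*}$. $W(p,p')=\omega(p')-\omega(p)-\langle\nabla\omega(p),p'-p\rangle$ is the Bregman distance of a function $\omega$ on $P$ that is 1-strongly convex with respect to $\|\cdot\|_W$; $W(p,p')$ is defined for $p$ where $\omega$ is differentiable (subdifferentiable) and $p'\in P$, and $p_0$ and all iterates $p_t$ are such points. (Cases of practical interest: $\|\cdot\|_2$ with Euclidean $W$; $\|\cdot\|_1$ with entropy $W$.) Constants. For the initial points $x_0\in X,p_0\in P,\pi_0\in\Pi$: $\Omega_X^2=\max_{x\in X}V(x_0,x)$, $\Omega_P^2=\max_{p\in P}W(p_0,p)$, $\Omega_\Pi^2=\max_k\sup_{\pi_k\in\Pi(k)}U(\pi_{0,k},\pi_k)$; $M_T=\max_k\|T_k\|_{2,2}$ (spectral norm); $M_\Pi=\max_k\sup_{\pi_k\in\Pi(k)}\|\pi_k\|_2$. $C_p\ge0$ is any constant with $\bigl\|(\|\pi_1\|_2,\dots,\|\pi_K\|_2)\bigr\|_{W^*}\le C_p\max_k\|\pi_k\|_2$ for all $\pi\in\Pi$. All of these constants are positive, so that the stepsizes are well defined and positive. SD algorithm with stepsizes $\sigma,\tau,\eta>0$: set $x_{-1}=x_0$; for $t=1,\dots,N$: (1) $\tilde x_t=2x_{t-1}-x_{t-2}$; (2) for every $k$, $\pi_{k,t}=\arg\max_{\pi_k\in\Pi(k)}\langle T_k\tilde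 x_t,\pi_k\rangle-g_k^*(\pi_k)-\sigma U(\pi_{k,t-1},\pi_k)$; (3) $\tilde f_{t,k}=\langle T_kx_{t-1},\pi_{k,t}\rangle+\langle T_k(x_{t-1}-x_{t-2}),\pi_{k,t-1}\rangle-g_k^*(\pi_{k,t})$ for every $k$; (4) $p_t=\arg\max_{p\in P}\sum_kp_k\tilde f_{t,k}-\phi^*(p)-\tau W(p_{t-1},p)$; (5) $x_t=\arg\min_{x\in X}f_0(x)+\sum_kp_{t,k}\langle T_kx,\pi_{k,t}\rangle+\eta V(x_{t-1},x)$.
   Formalization: The norm on R^K is assumed absolute (it depends only on the absolute values of the coordinates), and at the iterates ω is assumed differentiable relative to P, with ∇ω that gradient; for a general norm, or an arbitrary choice of subgradient, the bound can fail. *)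

theory Defs
  imports "HOL-Analysis.Analysis"
begin

text \<open>
  The dimensions m_k of the blocks differ with k. The space R^(m_k) is the coordinate subspace of
  one common real^'m that belongs to a set J k of m_k indices, with the inner product and norm
  inherited from real^'m. Every family (m_k) arises in this way, since 'm is arbitrary.
\<close>

definition coord_space :: "'m set \<Rightarrow> (real^'m) set" where
  "coord_space I = {v. \<forall>i. i \<notin> I \<longrightarrow> v $ i = 0}"

definition fenchel_conj :: "'a::real_inner set \<Rightarrow> ('a \<Rightarrow> real) \<Rightarrow> 'a \<Rightarrow> ereal" where
  "fenchel_conj S g v = (SUP y\<in>S. ereal (y \<bullet> v - g y))"

definition conj_dom :: "'a::real_inner set \<Rightarrow> ('a \<Rightarrow> real) \<Rightarrow> 'a set" where
  "conj_dom S g = {v \<in> S. fenchel_conj S g v < \<infinity>}"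

definition closed_convex_on :: "'a::euclidean_space set \<Rightarrow> ('a \<Rightarrow> real) \<Rightarrow> bool" where
  "closed_convex_on S h \<longleftrightarrow> convex_on S h \<and> closed (epigraph S h)"

definition is_norm :: "('a::real_vector \<Rightarrow> real) \<Rightarrow> bool" where
  "is_norm \<nu> \<longleftrightarrow>
     (\<forall>v. 0 \<le> \<nu> v) \<and> (\<forall>v. \<nu> v = 0 \<longleftrightarrow> v = 0) \<and>
     (\<forall>c v. \<nu> (c *\<^sub>R v) = \<bar>c\<bar> * \<nu> v) \<and> (\<forall>u v. \<nu> (u + v) \<le> \<nu> u + \<nu> v)"

definition dual_norm :: "('a::real_inner \<Rightarrow> real) \<Rightarrow> 'a \<Rightarrow> real" where
  "dual_norm \<nu> u = (SUP v\<in>{v. \<nu> v \<le> 1}. u \<bullet> v)"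

text \<open>
  The norm depends only on the absolute values of the coordinates (as all l_p norms do). Its dual
  norm is then monotone in the absolute values of the coordinates, so that a bound on the dual
  norm of the vector of the norms of the pi_k also bounds that of the vector of the inner products
  of pi_k with T_k d. The bound of the theorem fails for some norms that are not absolute.
\<close>

definition absolute_norm :: "(real^'k \<Rightarrow> real) \<Rightarrow> bool" where
  "absolute_norm \<nu> \<longleftrightarrow> (\<forall>v. \<nu> (\<chi> k. \<bar>v $ k\<bar>) = \<nu> v)"

definition strongly_convex_wrt ::
    "('a::real_vector \<Rightarrow> real) \<Rightarrow> 'a set \<Rightarrow> ('a \<Rightarrow> real) \<Rightarrow> bool" where
  "strongly_convex_wrt \<nu> S \<omega> \<longleftrightarrow>
     (\<forall>u\<in>S. \<forall>v\<in>S. \<forall>s\<in>{0..1}.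
        \<omega> ((1 - s) *\<^sub>R u + s *\<^sub>R v)
          \<le> (1 - s) * \<omega> u + s * \<omega> v - s * (1 - s) / 2 * (\<nu> (u - v))\<^sup>2)"

text \<open>
  Since a set P of probability vectors has empty interior, the gradient is taken relative to P.
  It need not be unique, but its inner products with p' - p, for p' in the convex set P,
  are, so that the Bregman distance below does not depend on the choice.
\<close>

definition is_gradient_within ::
    "'a::real_inner set \<Rightarrow> ('a \<Rightarrow> real) \<Rightarrow> 'a \<Rightarrow> 'a \<Rightarrow> bool" where
  "is_gradient_within S \<omega> p d \<longleftrightarrow> (\<omega> has_derivative (\<lambda>h. d \<bullet> h)) (at p within S)"

definition bregman :: "('a::real_inner \<Rightarrow> real) \<Rightarrow> ('a \<Rightarrow> 'a) \<Rightarrow> 'a \<Rightarrow> 'a \<Rightarrow> real" where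
  "bregman \<omega> grad p p' = \<omega> p' - \<omega> p - grad p \<bullet> (p' - p)"

definition half_sqdist :: "'a::real_inner \<Rightarrow> 'a \<Rightarrow> real" where
  "half_sqdist u v = (norm (u - v))\<^sup>2 / 2"

text \<open>
  The supremum over P is a maximum, because P is nonempty and compact and phi is lower
  semicontinuous on P.
\<close>

definition risk_objective ::
    "(real^'k) set \<Rightarrow> (real^'n \<Rightarrow> real) \<Rightarrow> (real^'k \<Rightarrow> real) \<Rightarrow> ('k \<Rightarrow> real^'n^'m)
      \<Rightarrow> ('k \<Rightarrow> real^'m \<Rightarrow> real) \<Rightarrow> real^'n \<Rightarrow> real" where
  "risk_objective P f0 \<phi> T g x =
     f0 x + (SUP p\<in>P. (\<Sum>k\<in>UNIV. p $ k * g k (T k *v x)) - \<phi> p)"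

text \<open>
  A run of the algorithm; index 0 holds the initial points. The convention that x at index -1
  equals x 0 is built into truncated subtraction: for t = 1, the term x (t - 2) is x 0.
  The conjugate is finite on conj_dom, so passing to real numbers is harmless there.
\<close>

definition sd_run ::
    "(real^'n) set \<Rightarrow> (real^'k) set \<Rightarrow> (real^'n \<Rightarrow> real) \<Rightarrow> (real^'k \<Rightarrow> real)
      \<Rightarrow> ('k \<Rightarrow> (real^'m) set) \<Rightarrow> ('k \<Rightarrow> real^'n^'m) \<Rightarrow> ('k \<Rightarrow> real^'m \<Rightarrow> real)
      \<Rightarrow> (real^'k \<Rightarrow> real^'k \<Rightarrow> real) \<Rightarrow> real \<Rightarrow> real \<Rightarrow> real \<Rightarrow> nat
      \<Rightarrow> (nat \<Rightarrow> real^'n) \<Rightarrow> (nat \<Rightarrow> real^'k) \<Rightarrow> (nat \<Rightarrow> 'k \<Rightarrow> real^'m) \<Rightarrow> bool" where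
  "sd_run X P f0 \<phi> S T g W \<sigma> \<tau> \<eta> N x p \<pi> \<longleftrightarrow>
     (\<forall>t\<in>{1..N}.
        let xt = 2 *\<^sub>R x (t - 1) - x (t - 2);
            gc = (\<lambda>k v. real_of_ereal (fenchel_conj (S k) (g k) v));
            ft = (\<lambda>k. (T k *v x (t - 1)) \<bullet> \<pi> t k
                       + (T k *v (x (t - 1) - x (t - 2))) \<bullet> \<pi> (t - 1) k
                       - gc k (\<pi> t k))
        in (\<forall>k. is_arg_max
                  (\<lambda>v. (T k *v xt) \<bullet> v - gc k v - \<sigma> * half_sqdist (\<pi> (t - 1) k) v)
                  (\<lambda>v. v \<in> conj_dom (S k) (g k)) (\<pi> t k))
           \<and> is_arg_max
               (\<lambda>q. (\<Sum>k\<in>UNIV. q $ k * ft k) - \<phi> q - \<tau> * W (p (t - 1)) q)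
               (\<lambda>q. q \<in> P) (p t)
           \<and> is_arg_min
               (\<lambda>y. f0 y + (\<Sum>k\<in>UNIV. p t $ k * ((T k *v y) \<bullet> \<pi> t k))
                     + \<eta> * half_sqdist (x (t - 1)) y)
               (\<lambda>y. y \<in> X) (x t))"

end

(*
  The gap L(x_t, p, pi) - L(x*, p_t, pi_t) of the Lagrangian
  L(x, p, pi) = f0(x) + sum_k p_k (<T_k x, pi_k> - g_k^*(pi_k)) - phi(p) splits into a pi-part, a
  p-part and an x-part, each controlled by the three-point inequality of its proximal step. The
  extrapolation makes the coupling terms of the two dual parts telescope; what remains of them is
  absorbed by the Bregman terms up to multiples of sum_t |x_t - x_{t-1}|^2, and for the given
  stepsizes these multiples add up to the eta/2 that the x-part provides. As f(x) is the maximum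
  of L over (p, pi), attained in pi at subgradients of the g_k, averaging over t gives the bound.
*)

theory Submission
  imports Defs
begin

section \<open>Proximal steps\<close>

text \<open>A derivative relative to \<open>C\<close> only tests directions that stay in
  \<open>C\<close>. The segment from \<open>u\<close> to \<open>v\<close> does so by convexity, and
  the chain rule along it gives the one-sided quotient.\<close>

lemma directional_derivative_within:
  fixes h :: "'a::real_normed_vector \<Rightarrow> real"
  assumes "(h has_derivative h') (at u within C)" "convex C" "u \<in> C" "v \<in> C"
  shows "((\<lambda>s. (h (u + s *\<^sub>R (v - u)) - h u) / s) \<longlongrightarrow> h' (v - u)) (at_right 0)"
proof -
  have mem: "u + s *\<^sub>R (v - u) \<in> C" if "s \<in> {0..1}" for s
  proof -
    have "u + s *\<^sub>R (v - u) = (1 - s) *\<^sub>R u + s *\<^sub>R v" by (simp add: algebra_simps)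
    then show ?thesis using convexD[OF assms(2-4), of "1 - s" s] that by simp
  qed
  have line: "((\<lambda>s. u + s *\<^sub>R (v - u)) has_derivative (\<lambda>s. s *\<^sub>R (v - u))) (at 0 within {0..1})"
    by (auto intro!: derivative_eq_intros)
  have "(h has_derivative h') (at (u + 0 *\<^sub>R (v - u)) within (\<lambda>s. u + s *\<^sub>R (v - u)) ` {0..1})"
    using mem by (auto intro!: has_derivative_subset[OF assms(1)])
  from has_derivative_in_compose[OF line this]
  have "((\<lambda>s. h (u + s *\<^sub>R (v - u))) has_derivative (\<lambda>s. h' (s *\<^sub>R (v - u)))) (at 0 within {0..1})" .
  moreover have "h' (s *\<^sub>R (v - u)) = s * h' (v - u)" for s
    using has_derivative_bounded_linear[OF assms(1)]
    by (simp add: linear_simps(5) bounded_linear.linear linear_scale)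
  ultimately have "((\<lambda>s. h (u + s *\<^sub>R (v - u))) has_real_derivative h' (v - u)) (at 0 within {0..1})"
    by (simp add: has_field_derivative_def mult_commute_abs)
  then have "((\<lambda>s. (h (u + s *\<^sub>R (v - u)) - h u) / s) \<longlongrightarrow> h' (v - u)) (at 0 within {0..1})"
    by (simp add: has_field_derivative_iff)
  then show ?thesis
    by (simp add: at_within_Icc_at_right)
qed

text \<open>Moving from the minimizer \<open>u\<close> a fraction \<open>s\<close> towards
  \<open>v\<close> raises \<open>\<psi>\<close> by at most \<open>s * (\<psi> v - \<psi> u)\<close>.
  Dividing the optimality inequality by \<open>s\<close> and letting \<open>s\<close> tend to 0
  leaves a derivative of the smooth part \<open>h\<close> only.\<close>

lemma convex_composite_min_first_order:
  fixes \<psi> h :: "'a::real_normed_vector \<Rightarrow> real"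
  assumes "convex_on C \<psi>" and h: "(h has_derivative h') (at u within C)"
    and uv: "u \<in> C" "v \<in> C"
    and min: "\<And>w. w \<in> C \<Longrightarrow> \<psi> u + h u \<le> \<psi> w + h w"
  shows "\<psi> u - \<psi> v \<le> h' (v - u)"
proof (rule tendsto_lowerbound[OF directional_derivative_within[OF h _ uv]])
  show C: "convex C" using assms(1) by (simp add: convex_on_def)
  have "\<psi> u - \<psi> v \<le> (h (u + s *\<^sub>R (v - u)) - h u) / s" if s: "s \<in> {0<..<1}" for s
  proof -
    have eq: "u + s *\<^sub>R (v - u) = (1 - s) *\<^sub>R u + s *\<^sub>R v" by (simp add: algebra_simps)
    then have "u + s *\<^sub>R (v - u) \<in> C" using convexD[OF C uv, of "1 - s" s] s by simp
    then have "\<psi> u + h u \<le> \<psi> (u + s *\<^sub>R (v - u)) + h (u + s *\<^sub>R (v - u))" by (rule min)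
    also have "\<psi> (u + s *\<^sub>R (v - u)) \<le> (1 - s) * \<psi> u + s * \<psi> v"
      unfolding eq using convex_onD[OF assms(1), of s u v] s uv by simp
    finally show ?thesis using s by (simp add: field_simps)
  qed
  then show "\<forall>\<^sub>F s in at_right 0. \<psi> u - \<psi> v \<le> (h (u + s *\<^sub>R (v - u)) - h u) / s"
    unfolding eventually_at_right[OF zero_less_one] by (intro exI[of _ 1]) simp
qed simp

text \<open>The gradient of \<open>bregman \<omega> grad z\<close> at \<open>a\<close> is
  \<open>grad a - grad z\<close>, and its inner product with \<open>v - a\<close> is exactly the
  combination of three distances on the right.\<close>

lemma bregman_three_point:
  assumes \<psi>: "convex_on C \<psi>" and d: "is_gradient_within C \<omega> a (grad a)"
    and C: "a \<in> C" "v \<in> C"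
    and min: "\<And>w. w \<in> C \<Longrightarrow> \<psi> a + c * bregman \<omega> grad z a \<le> \<psi> w + c * bregman \<omega> grad z w"
  shows "\<psi> a - \<psi> v \<le> c * (bregman \<omega> grad z v - bregman \<omega> grad a v - bregman \<omega> grad z a)"
proof -
  have "((\<lambda>w. c * bregman \<omega> grad z w) has_derivative (\<lambda>w. c * (grad a \<bullet> w - grad z \<bullet> w))) (at a within C)"
    using d unfolding is_gradient_within_def bregman_def
    by (auto intro!: derivative_eq_intros)
  from convex_composite_min_first_order[OF \<psi> this C min] show ?thesis
    by (simp add: bregman_def algebra_simps)
qed

lemma convex_on_add_inner:
  assumes "convex_on C \<psi>"
  shows "convex_on C (\<lambda>v. \<psi> v + c \<bullet> v)"
proof -
  have "convex_on C (\<lambda>v. c \<bullet> v)"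
    using assms by (simp add: convex_on_def inner_simps)
  with assms show ?thesis by (rule convex_on_add)
qed

lemma half_sqdist_eq_bregman:
  "half_sqdist u v = bregman (\<lambda>w. (norm w)\<^sup>2 / 2) (\<lambda>w. w) u v"
  unfolding half_sqdist_def bregman_def power2_norm_eq_inner
  by (simp add: inner_diff inner_commute field_simps)

lemma half_sqdist_three_point:
  assumes "convex_on C \<psi>" "a \<in> C" "v \<in> C"
    and "\<And>w. w \<in> C \<Longrightarrow> \<psi> a + c * half_sqdist z a \<le> \<psi> w + c * half_sqdist z w"
  shows "\<psi> a - \<psi> v \<le> c * (half_sqdist z v - half_sqdist a v - half_sqdist z a)"
proof -
  have "((\<lambda>w. 1 / 2 * (w \<bullet> w)) has_derivative (\<lambda>h. 1 / 2 * (a \<bullet> h + h \<bullet> a))) (at a within C)"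
    by (intro derivative_intros)
  then have "is_gradient_within C (\<lambda>w. (norm w)\<^sup>2 / 2) a a"
    by (simp add: is_gradient_within_def power2_norm_eq_inner inner_commute)
  from bregman_three_point[where grad = "\<lambda>w. w", OF assms(1) this] assms(2-) show ?thesis
    by (simp add: half_sqdist_eq_bregman)
qed

text \<open>Strong convexity on the segment, divided by \<open>s\<close>, bounds the difference
  quotient of \<open>\<omega>\<close> by \<open>?R s\<close>. In the limit the quotient becomes
  \<open>grad a \<bullet> (b - a)\<close>.\<close>

lemma bregman_ge_strongly_convex:
  assumes sc: "strongly_convex_wrt \<nu> C \<omega>" and d: "is_gradient_within C \<omega> a (grad a)"
    and C: "convex C" "a \<in> C" "b \<in> C"
  shows "(\<nu> (a - b))\<^sup>2 / 2 \<le> bregman \<omega> grad a b"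
proof -
  let ?R = "\<lambda>s. \<omega> b - \<omega> a - (1 - s) / 2 * (\<nu> (a - b))\<^sup>2"
  have "grad a \<bullet> (b - a) \<le> ?R 0"
  proof (rule tendsto_le[OF _ _ directional_derivative_within[OF d[unfolded is_gradient_within_def] C]])
    show "(?R \<longlongrightarrow> ?R 0) (at_right 0)" by (intro tendsto_intros) simp
    have "(\<omega> (a + s *\<^sub>R (b - a)) - \<omega> a) / s \<le> ?R s" if s: "s \<in> {0<..<1}" for s
    proof -
      have "a + s *\<^sub>R (b - a) = (1 - s) *\<^sub>R a + s *\<^sub>R b" by (simp add: algebra_simps)
      then have "\<omega> (a + s *\<^sub>R (b - a)) \<le> (1 - s) * \<omega> a + s * \<omega> b - s * (1 - s) / 2 * (\<nu> (a - b))\<^sup>2"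
        using sc C s unfolding strongly_convex_wrt_def by simp
      then have "\<omega> (a + s *\<^sub>R (b - a)) - \<omega> a \<le> ?R s * s" by (simp add: algebra_simps)
      then show ?thesis using s by (simp add: pos_divide_le_eq)
    qed
    then show "\<forall>\<^sub>F s in at_right 0. (\<omega> (a + s *\<^sub>R (b - a)) - \<omega> a) / s \<le> ?R s"
      unfolding eventually_at_right[OF zero_less_one] by (intro exI[of _ 1]) simp
  qed simp
  then show ?thesis by (simp add: bregman_def)
qed

text \<open>
  Common to both dual updates: \<open>B\<close> is the Bregman distance to the reference point, \<open>E\<close> the one
  between consecutive iterates, \<open>A\<close> the coupling with the primal step, and \<open>D\<close> the squared
  length of that step.
\<close>

lemma extrapolated_telescope:
  fixes gap B A R D E :: "nat \<Rightarrow> real"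
  assumes step: "\<And>t. t \<in> {1..N} \<Longrightarrow> gap t \<le> c * (B (t - 1) - B t - E t) + A t - A (t - 1) + R t"
    and R: "\<And>t. t \<in> {1..N} \<Longrightarrow> R t \<le> c * E t + \<kappa> * D (t - 1)"
    and AN: "A N \<le> c * B N + \<kappa> * D N" and zero: "A 0 = 0" "D 0 = 0"
  shows "(\<Sum>t=1..N. gap t) \<le> c * B 0 + \<kappa> * (\<Sum>t=1..N. D t)"
proof -
  \<comment> \<open>The invariant holds \<open>D n\<close> back: \<open>R (Suc n)\<close> consumes
    it in the next step, and the final coupling \<open>A N\<close> consumes
    \<open>D N\<close>.\<close>
  have "n \<le> N \<Longrightarrow> (\<Sum>t=1..n. gap t) \<le> c * (B 0 - B n) + A n + \<kappa> * ((\<Sum>t=1..n. D t) - D n)" for n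
  proof (induction n)
    case (Suc n)
    then show ?case using step[of "Suc n"] R[of "Suc n"] by (simp add: algebra_simps)
  qed (simp add: zero)
  from this[of N] AN show ?thesis by (simp add: algebra_simps)
qed

section \<open>Norms and conjugates\<close>

lemma young_bound:
  fixes a b c m :: real
  assumes "c > 0"
  shows "m * a * b \<le> c * (b\<^sup>2 / 2) + m\<^sup>2 / (2 * c) * a\<^sup>2"
proof -
  have "0 \<le> (c * b - m * a)\<^sup>2 / (2 * c)" using assms by simp
  also have "\<dots> = c * (b\<^sup>2 / 2) + m\<^sup>2 / (2 * c) * a\<^sup>2 - m * a * b"
    using assms by (simp add: field_simps power2_eq_square)
  finally show ?thesis by simp
qed

lemma absolute_norm_axis_le:
  assumes "is_norm \<nu>" "absolute_norm \<nu>"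
  shows "\<bar>v $ k\<bar> * \<nu> (axis k 1) \<le> \<nu> v"
proof -
  \<comment> \<open>Flipping the signs of the other coordinates keeps the norm and cancels them in the sum.\<close>
  define w where "w = (\<chi> j. if j = k then v $ j else - v $ j)"
  have "\<nu> w = \<nu> (\<chi> j. \<bar>w $ j\<bar>)" using assms(2) by (simp add: absolute_norm_def)
  also have "(\<chi> j. \<bar>w $ j\<bar>) = (\<chi> j. \<bar>v $ j\<bar>)" by (simp add: w_def vec_eq_iff)
  also have "\<nu> \<dots> = \<nu> v" using assms(2) by (simp add: absolute_norm_def)
  finally have w: "\<nu> w = \<nu> v" .
  have "v + w = (2 * v $ k) *\<^sub>R axis k 1" by (auto simp: w_def vec_eq_iff axis_def)
  then have "2 * (\<bar>v $ k\<bar> * \<nu> (axis k 1)) = \<nu> (v + w)"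
    using assms(1) by (simp add: is_norm_def abs_mult)
  also have "\<dots> \<le> 2 * \<nu> v" using assms(1) w unfolding is_norm_def by (metis mult_2)
  finally show ?thesis by simp
qed

text \<open>A supremum of reals dominates its members only if they are bounded above. The coordinate
  estimate \<open>absolute_norm_axis_le\<close> bounds \<open>u \<bullet> w\<close> over the unit
  ball of \<open>\<nu>\<close>; then \<open>v\<close> is scaled to length 1.\<close>

lemma inner_le_dual_norm:
  assumes n: "is_norm \<nu>" "absolute_norm \<nu>"
  shows "u \<bullet> v \<le> dual_norm \<nu> u * \<nu> v"
proof (cases "v = 0")
  case False
  have pos: "\<nu> w > 0" if "w \<noteq> 0" for w using n(1) that unfolding is_norm_def
    by (metis less_le)
  have "u \<bullet> w \<le> (\<Sum>k\<in>UNIV. \<bar>u $ k\<bar> / \<nu> (axis k 1))" if "\<nu> w \<le> 1" for w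
    unfolding inner_vec_def
  proof (rule sum_mono)
    fix k
    have ax: "\<nu> (axis k 1) > 0" by (rule pos) simp
    have "\<bar>w $ k\<bar> * \<nu> (axis k 1) \<le> 1" using absolute_norm_axis_le[OF n] that by (rule order_trans)
    then have "\<bar>w $ k\<bar> \<le> 1 / \<nu> (axis k 1)" using ax by (simp add: field_simps)
    then have "\<bar>u $ k\<bar> * \<bar>w $ k\<bar> \<le> \<bar>u $ k\<bar> * (1 / \<nu> (axis k 1))" by (rule mult_left_mono) simp
    moreover have "u $ k * w $ k \<le> \<bar>u $ k\<bar> * \<bar>w $ k\<bar>" by (metis abs_ge_self abs_mult)
    ultimately show "u $ k \<bullet> w $ k \<le> \<bar>u $ k\<bar> / \<nu> (axis k 1)" by simp
  qed
  then have "bdd_above ((\<lambda>w. u \<bullet> w) ` {w. \<nu> w \<le> 1})" by (auto intro!: bdd_aboveI2)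
  moreover have "\<nu> ((1 / \<nu> v) *\<^sub>R v) \<le> 1"
    using n(1) pos[OF False] by (simp add: is_norm_def)
  ultimately have "u \<bullet> ((1 / \<nu> v) *\<^sub>R v) \<le> dual_norm \<nu> u"
    unfolding dual_norm_def by (intro cSUP_upper) auto
  then show ?thesis using pos[OF False] by (simp add: field_simps)
next
  case True
  then have "\<nu> v = 0" using n(1) unfolding is_norm_def by blast
  then show ?thesis using True by simp
qed

section \<open>Fenchel conjugates and subgradients\<close>

lemma fenchel_conj_upper:
  assumes "v \<in> conj_dom S g" "y \<in> S"
  shows "y \<bullet> v - g y \<le> real_of_ereal (fenchel_conj S g v)"
proof -
  have "ereal (y \<bullet> v - g y) \<le> fenchel_conj S g v"
    unfolding fenchel_conj_def using assms(2) by (rule SUP_upper)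
  then show ?thesis using assms(1) unfolding conj_dom_def
    by (cases "fenchel_conj S g v") auto
qed

text \<open>A point of \<open>S\<close> excludes the value \<open>-\<infinity>\<close>, which
  \<open>real_of_ereal\<close> would turn into 0, possibly above \<open>c\<close>.\<close>

lemma fenchel_conj_least:
  assumes "S \<noteq> {}" "\<And>y. y \<in> S \<Longrightarrow> y \<bullet> v - g y \<le> c"
  shows "real_of_ereal (fenchel_conj S g v) \<le> c" and "v \<in> S \<Longrightarrow> v \<in> conj_dom S g"
proof -
  obtain y where "y \<in> S" using assms(1) by blast
  then have "ereal (y \<bullet> v - g y) \<le> fenchel_conj S g v"
    unfolding fenchel_conj_def by (rule SUP_upper)
  moreover have le: "fenchel_conj S g v \<le> ereal c"
    unfolding fenchel_conj_def using assms(2) by (intro SUP_least) simp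
  ultimately show "real_of_ereal (fenchel_conj S g v) \<le> c"
    by (cases "fenchel_conj S g v") auto
  show "v \<in> conj_dom S g" if "v \<in> S"
    using le that unfolding conj_dom_def by (auto simp: le_less_trans)
qed

text \<open>The conjugate is a supremum of affine functions. The single estimate
  \<open>bound\<close> yields both the inequality and the convexity of the domain, which
  \<open>convex_on\<close> includes.\<close>

lemma convex_on_fenchel_conj:
  assumes S: "convex S" "S \<noteq> {}"
  shows "convex_on (conj_dom S g) (\<lambda>v. real_of_ereal (fenchel_conj S g v))" (is "convex_on ?D ?G")
proof -
  have bound: "y \<bullet> (s *\<^sub>R u + r *\<^sub>R v) - g y \<le> s * ?G u + r * ?G v"
    if "u \<in> ?D" "v \<in> ?D" "0 \<le> s" "0 \<le> r" "s + r = 1" "y \<in> S" for s r :: real and u v y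
  proof -
    have "y \<bullet> (s *\<^sub>R u + r *\<^sub>R v) - g y = s * (y \<bullet> u - g y) + r * (y \<bullet> v - g y)"
      using that(5) by (simp add: algebra_simps) (metis distrib_left mult.commute mult_1)
    also have "\<dots> \<le> s * ?G u + r * ?G v"
      using that by (intro add_mono mult_left_mono fenchel_conj_upper)
    finally show ?thesis .
  qed
  have mem: "s *\<^sub>R u + r *\<^sub>R v \<in> S" if "u \<in> ?D" "v \<in> ?D" "0 \<le> s" "0 \<le> r" "s + r = 1" for s r u v
    using that convexD[OF S(1)] by (simp add: conj_dom_def)
  show ?thesis unfolding convex_on_def convex_def
  proof (intro conjI ballI allI impI)
    fix u v and s r :: real
    assume uv: "u \<in> ?D" "v \<in> ?D" "0 \<le> s" "0 \<le> r" "s + r = 1"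
    show "s *\<^sub>R u + r *\<^sub>R v \<in> ?D"
      by (rule fenchel_conj_least(2)[OF S(2) bound[OF uv] mem[OF uv]])
    show "?G (s *\<^sub>R u + r *\<^sub>R v) \<le> s * ?G u + r * ?G v"
      by (rule fenchel_conj_least(1)[OF S(2) bound[OF uv]])
  qed
qed

text \<open>Along the ray \<open>s *\<^sub>R v\<close> the expression under the supremum grows at
  least at the rate \<open>norm v * (norm v - L)\<close>, so the conjugate is infinite once
  \<open>norm v\<close> exceeds \<open>L\<close>.\<close>

lemma conj_dom_norm_le_lipschitz:
  assumes S: "subspace S" and L: "L-lipschitz_on S g" and v: "v \<in> conj_dom S g"
  shows "norm v \<le> L"
proof (rule ccontr)
  assume "\<not> norm v \<le> L"
  then have L': "L < norm v" by simp
  then have nv: "norm v > 0" using lipschitz_on_nonneg[OF L] by (rule order_le_less_trans[rotated])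
  let ?G = "real_of_ereal (fenchel_conj S g v)"
  let ?e = "norm v * (norm v - L)"
  have e: "?e > 0" using nv L' by simp
  have vS: "v \<in> S" using v by (simp add: conj_dom_def)
  have "s * ?e \<le> ?G + g 0" if s: "s \<ge> 0" for s
  proof -
    have mem: "s *\<^sub>R v \<in> S" "0 \<in> S" using S vS by (auto simp: subspace_def)
    have "g (s *\<^sub>R v) - g 0 \<le> L * (s * norm v)"
      using lipschitz_onD[OF L mem] s by (auto simp: dist_norm)
    moreover have "s * (norm v)\<^sup>2 - g (s *\<^sub>R v) \<le> ?G"
      using fenchel_conj_upper[OF v mem(1)] by (simp add: power2_norm_eq_inner)
    ultimately show ?thesis by (simp add: algebra_simps power2_eq_square)
  qed
  moreover obtain n where "?G + g 0 < real n * ?e" using reals_Archimedean3[OF e] by blast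
  ultimately show False using of_nat_0_le_iff leD by metis
qed

text \<open>A hyperplane separating \<open>(z, h z)\<close> from the strict epigraph has the
  subgradient as its slope.\<close>

lemma convex_on_UNIV_subgradient:
  fixes h :: "'a::euclidean_space \<Rightarrow> real"
  assumes "convex_on UNIV h"
  obtains v where "\<And>y. h z + v \<bullet> (y - z) \<le> h y"
proof -
  define A where "A = {w. h (fst w) < snd w}"
  have "convex A"
    unfolding convex_alt A_def
  proof (clarsimp)
    fix a b a' b' u :: real and y y' assume *: "h y < b" "h y' < b'" "0 \<le> u" "u \<le> 1"
    have "h ((1 - u) *\<^sub>R y + u *\<^sub>R y') \<le> (1 - u) * h y + u * h y'"
      using convex_onD[OF assms] * by simp
    also have "\<dots> < (1 - u) * b + u * b'"
      using * by (smt (verit) mult_left_mono mult_strict_left_mono)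
    finally show "h ((1 - u) *\<^sub>R y + u *\<^sub>R y') < (1 - u) * b + u * b'" .
  qed
  moreover have "(z, h z + 1) \<in> A" "A \<inter> {(z, h z)} = {}" by (auto simp: A_def)
  ultimately have "\<exists>a b. a \<noteq> 0 \<and> (\<forall>w\<in>{(z, h z)}. a \<bullet> w \<le> b) \<and> (\<forall>w\<in>A. b \<le> a \<bullet> w)"
    by (intro separating_hyperplane_sets) auto
  then obtain a b where ab: "a \<noteq> 0" "\<forall>w\<in>A. a \<bullet> w \<ge> b" "a \<bullet> (z, h z) \<le> b"
    by blast
  obtain u c where a: "a = (u, c)" by (cases a)
  have ineq: "u \<bullet> z + c * h z \<le> u \<bullet> y + c * r" if "h y < r" for y r
    using ab(2,3) that unfolding A_def a by fastforce
  have c0: "c \<ge> 0" using ineq[of z "h z + 1"] by (simp add: algebra_simps)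
  \<comment> \<open>As \<open>h\<close> is finite everywhere, a vertical hyperplane would make
    \<open>z\<close> a minimizer of the linear form \<open>u\<close> on the whole space; the test
    point \<open>z - u\<close> then forces \<open>u = 0\<close>.\<close>
  have "c \<noteq> 0"
  proof
    assume "c = 0"
    then have "u \<bullet> z \<le> u \<bullet> (z - u)" using ineq[of "z - u" "h (z - u) + 1"] by simp
    then have "u \<bullet> u \<le> 0" by (simp add: inner_diff_right)
    then have "u = 0" by (metis inner_eq_zero_iff inner_ge_zero order_antisym)
    then show False using ab(1) a \<open>c = 0\<close> by (simp add: zero_prod_def)
  qed
  with c0 have c: "c > 0" by simp
  show ?thesis
  proof (rule that[of "- u /\<^sub>R c"])
    fix y
    \<comment> \<open>\<open>ineq\<close> covers heights strictly above \<open>h y\<close>, so the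
      height \<open>h y\<close> itself is reached in the limit.\<close>
    have "h z + (u \<bullet> z - u \<bullet> y) / c \<le> h y"
    proof (rule field_le_epsilon)
      fix e :: real assume "e > 0"
      then show "h z + (u \<bullet> z - u \<bullet> y) / c \<le> h y + e"
        using ineq[of y "h y + e"] c by (simp add: field_simps)
    qed
    then show "h z + (- u /\<^sub>R c) \<bullet> (y - z) \<le> h y"
      by (simp add: inner_diff_right diff_divide_distrib divide_inverse algebra_simps)
  qed
qed

lemma subspace_coord_space: "subspace (coord_space I)"
  by (simp add: subspace_def coord_space_def)

text \<open>Composition with the orthogonal projection \<open>pr\<close> extends \<open>g\<close> to
  a convex function on the whole space. Projecting a subgradient of the extension gives a
  \<open>v\<close> for which the supremum defining the conjugate is attained at
  \<open>z\<close>.\<close>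

lemma fenchel_biconjugate_attained:
  fixes g :: "real^'m \<Rightarrow> real"
  assumes g: "convex_on (coord_space I) g" and z: "z \<in> coord_space I"
  obtains v where "v \<in> conj_dom (coord_space I) g"
    "g z \<le> z \<bullet> v - real_of_ereal (fenchel_conj (coord_space I) g v)"
proof -
  define pr :: "real^'m \<Rightarrow> real^'m" where "pr = (\<lambda>y. \<chi> i. if i \<in> I then y $ i else 0)"
  have prS: "pr y \<in> coord_space I" for y by (simp add: pr_def coord_space_def)
  have prid: "pr y = y" if "y \<in> coord_space I" for y
    using that by (auto simp: pr_def coord_space_def vec_eq_iff)
  have inner_pr: "y \<bullet> pr v = y \<bullet> v" if "y \<in> coord_space I" for y v
    using that by (auto simp: pr_def coord_space_def inner_vec_def intro!: sum.cong)
  have prlin: "pr (s *\<^sub>R y + r *\<^sub>R y') = s *\<^sub>R pr y + r *\<^sub>R pr y'" for s r y y'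
    by (simp add: pr_def vec_eq_iff)
  have "convex_on UNIV (\<lambda>y. g (pr y))"
    using g prS unfolding convex_on_def prlin by simp
  then obtain v where v: "\<And>y. g (pr z) + v \<bullet> (y - z) \<le> g (pr y)"
    using convex_on_UNIV_subgradient[of "\<lambda>y. g (pr y)" z] by blast
  have le: "y \<bullet> pr v - g y \<le> z \<bullet> pr v - g z" if "y \<in> coord_space I" for y
    using v[of y] that z by (simp add: prid inner_pr inner_diff_right inner_commute)
  have ne: "coord_space I \<noteq> {}" using z by blast
  show ?thesis
    using that[of "pr v"] fenchel_conj_least[OF ne le] prS by force
qed

text \<open>If the values ran to \<open>-\<infinity>\<close>, the arguments would have a subsequence
  with limit \<open>l\<close> in \<open>P\<close>. At the fixed height \<open>\<phi> l - 1\<close>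
  it would eventually lie in the epigraph, and so would its limit.\<close>

lemma closed_epigraph_bdd_below:
  fixes \<phi> :: "'a::euclidean_space \<Rightarrow> real"
  assumes P: "compact P" and cl: "closed (epigraph P \<phi>)"
  shows "bdd_below (\<phi> ` P)"
proof (rule ccontr)
  assume "\<not> bdd_below (\<phi> ` P)"
  then have "\<forall>n::nat. \<exists>q\<in>P. \<phi> q < - real n" unfolding bdd_below_def by (metis imageE not_le)
  then obtain q where q: "\<And>n. q n \<in> P" "\<And>n::nat. \<phi> (q n) < - real n" by metis
  obtain l r where l: "l \<in> P" and r: "strict_mono r" "(q \<circ> r) \<longlonglongrightarrow> l"
    using P q(1) unfolding compact_def by metis
  have "(l, \<phi> l - 1) \<in> epigraph P \<phi>"
  proof (rule Lim_in_closed_set[OF cl])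
    show "(\<lambda>n. ((q \<circ> r) n, \<phi> l - 1)) \<longlonglongrightarrow> (l, \<phi> l - 1)" using r(2) by (intro tendsto_intros)
    have "\<forall>\<^sub>F n in sequentially. 1 - \<phi> l \<le> real n"
      using filterlim_real_sequentially unfolding filterlim_at_top by blast
    then show "\<forall>\<^sub>F n in sequentially. ((q \<circ> r) n, \<phi> l - 1) \<in> epigraph P \<phi>"
    proof eventually_elim
      case (elim n)
      have "real n \<le> real (r n)" using seq_suble[OF r(1)] by simp
      then show ?case using q[of "r n"] elim by (simp add: epigraph_def)
    qed
  qed simp
  then show False by (simp add: epigraph_def)
qed

theorem theorem2p6:
  fixes X :: "(real^'n) set" and P :: "(real^'k) set"
    and f0 :: "real^'n \<Rightarrow> real" and \<phi> :: "real^'k \<Rightarrow> real"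
    and J :: "'k \<Rightarrow> 'm::finite set" and S :: "'k \<Rightarrow> (real^'m) set"
    and T :: "'k \<Rightarrow> real^'n^'m" and g :: "'k \<Rightarrow> real^'m \<Rightarrow> real"
    and Pis :: "'k \<Rightarrow> (real^'m) set"
    and f :: "real^'n \<Rightarrow> real" and xopt :: "real^'n"
    and normW :: "real^'k \<Rightarrow> real" and \<omega> :: "real^'k \<Rightarrow> real"
    and grad :: "real^'k \<Rightarrow> real^'k" and W :: "real^'k \<Rightarrow> real^'k \<Rightarrow> real"
    and \<Omega>X \<Omega>P \<Omega>Pi MT MPi Cp \<sigma> \<tau> \<eta> :: real
    and N :: nat
    and x :: "nat \<Rightarrow> real^'n" and p :: "nat \<Rightarrow> real^'k" and \<pi> :: "nat \<Rightarrow> 'k \<Rightarrow> real^'m"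
  assumes X: "X \<noteq> {}" "convex X" "compact X"
    and P: "P \<noteq> {}" "convex P" "compact P"
    and P_prob: "\<And>q. q \<in> P \<Longrightarrow> (\<forall>k. 0 \<le> q $ k) \<and> (\<Sum>k\<in>UNIV. q $ k) = 1"
    and f0: "closed_convex_on X f0" "\<exists>L. L-lipschitz_on X f0"
    and phi: "closed_convex_on P \<phi>"
    and S_eq: "\<And>k. S k = coord_space (J k)"
    and T_block: "\<And>k i. i \<notin> J k \<Longrightarrow> row i (T k) = 0"
    and g: "\<And>k. convex_on (S k) (g k)" "\<And>k. \<exists>L. L-lipschitz_on (S k) (g k)"
    and Pi_eq: "\<And>k. Pis k = conj_dom (S k) (g k)"
    and f_eq: "f = risk_objective P f0 \<phi> T g"
    and xopt: "is_arg_min f (\<lambda>y. y \<in> X) xopt"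
    and normW: "is_norm normW" "absolute_norm normW"
    and omega: "strongly_convex_wrt normW P \<omega>"
    and W_eq: "W = bregman \<omega> grad"
    and init: "x 0 \<in> X" "p 0 \<in> P" "\<And>k. \<pi> 0 k \<in> Pis k"
    and OmegaX: "\<Omega>X = sqrt (SUP y\<in>X. half_sqdist (x 0) y)" "\<Omega>X > 0"
    and OmegaP_fin: "bdd_above (W (p 0) ` P)"
    and OmegaP: "\<Omega>P = sqrt (SUP q\<in>P. W (p 0) q)" "\<Omega>P > 0"
    and OmegaPi: "\<Omega>Pi = sqrt (MAX k. SUP v\<in>Pis k. half_sqdist (\<pi> 0 k) v)" "\<Omega>Pi > 0"
    and MT: "MT = (MAX k. onorm (\<lambda>y. T k *v y))" "MT > 0"
    and MPi: "MPi = (MAX k. SUP v\<in>Pis k. norm v)" "MPi > 0"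
    and Cp: "\<And>v. (\<And>k. v k \<in> Pis k) \<Longrightarrow> dual_norm normW (\<chi> k. norm (v k)) \<le> Cp * (MAX k. norm (v k))"
      "Cp > 0"
    and sigma: "\<sigma> = MT * \<Omega>X / \<Omega>Pi"
    and tau: "\<tau> = MT * MPi * Cp * \<Omega>X / \<Omega>P"
    and eta: "\<eta> = MT * MPi * Cp * \<Omega>P / \<Omega>X + MT * \<Omega>Pi / \<Omega>X"
    and N: "N \<ge> 1"
    and run: "sd_run X P f0 \<phi> S T g W \<sigma> \<tau> \<eta> N x p \<pi>"
    and grad: "\<And>t. t \<le> N \<Longrightarrow> is_gradient_within P \<omega> (p t) (grad (p t))"
  shows "f ((1 / real N) *\<^sub>R (\<Sum>t=1..N. x t)) - f xopt \<le> 2 * \<Omega>X * MT / real N * (\<Omega>Pi + Cp * MPi * \<Omega>P)"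
proof -

  \<comment> \<open>The run in terms of primal increments\<close>
  define G where "G = (\<lambda>k v. real_of_ereal (fenchel_conj (S k) (g k) v))"
  define d where "d = (\<lambda>t. x t - x (t - 1))"
  define a where "a = (\<lambda>t k. (T k *v x t) \<bullet> \<pi> t k - G k (\<pi> t k))"
  define ft where "ft = (\<lambda>t k. (T k *v x (t - 1)) \<bullet> \<pi> t k + (T k *v d (t - 1)) \<bullet> \<pi> (t - 1) k - G k (\<pi> t k))"
  define q where "q = (\<lambda>t. \<chi> k. (T k *v d t) \<bullet> \<pi> t k)"
  define D where "D = (\<Sum>t=1..N. (norm (d t))\<^sup>2)"
  define \<kappa> where "\<kappa> = MT * MPi * Cp"

  \<comment> \<open>Truncated subtraction turns \<open>x (0 - 1)\<close> into \<open>x 0\<close>,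
    the convention for the index -1. Both dual telescopes therefore start with zero
    coupling.\<close>
  have d0: "d 0 = 0" by (simp add: d_def)
  have run_d: "x (t - 1) - x (t - 2) = d (t - 1)" for t by (simp add: d_def numeral_2_eq_2)
  have run_\<pi>: "is_arg_max
        (\<lambda>v. (T k *v (x (t - 1) + d (t - 1))) \<bullet> v - G k v - \<sigma> * half_sqdist (\<pi> (t - 1) k) v)
        (\<lambda>v. v \<in> Pis k) (\<pi> t k)"
    and run_p: "is_arg_max (\<lambda>r. (\<Sum>k\<in>UNIV. r $ k * ft t k) - \<phi> r - \<tau> * W (p (t - 1)) r)
        (\<lambda>r. r \<in> P) (p t)"
    and run_x: "is_arg_min (\<lambda>y. f0 y + (\<Sum>k\<in>UNIV. p t $ k * ((T k *v y) \<bullet> \<pi> t k))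
          + \<eta> * half_sqdist (x (t - 1)) y)
        (\<lambda>y. y \<in> X) (x t)"
    if "t \<in> {1..N}" for t k
  proof -
    have "2 *\<^sub>R x (t - 1) - x (t - 2) = x (t - 1) + d (t - 1)"
      unfolding run_d[symmetric] by (simp add: scaleR_2)
    with run[unfolded sd_run_def Let_def, rule_format, OF that]
    show "is_arg_max
        (\<lambda>v. (T k *v (x (t - 1) + d (t - 1))) \<bullet> v - G k v - \<sigma> * half_sqdist (\<pi> (t - 1) k) v)
        (\<lambda>v. v \<in> Pis k) (\<pi> t k)"
      and "is_arg_max (\<lambda>r. (\<Sum>k\<in>UNIV. r $ k * ft t k) - \<phi> r - \<tau> * W (p (t - 1)) r)
        (\<lambda>r. r \<in> P) (p t)"
      and "is_arg_min (\<lambda>y. f0 y + (\<Sum>k\<in>UNIV. p t $ k * ((T k *v y) \<bullet> \<pi> t k))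
          + \<eta> * half_sqdist (x (t - 1)) y)
        (\<lambda>y. y \<in> X) (x t)"
      by (simp_all add: G_def ft_def Pi_eq run_d[simplified])
  qed
  have xX: "x t \<in> X" if "t \<le> N" for t
    using run_x[of t] init(1) that by (cases "t = 0") (auto simp: is_arg_min_def)
  have pP: "p t \<in> P" if "t \<le> N" for t
    using run_p[of t] init(2) that by (cases "t = 0") (auto simp: is_arg_max_def)
  have \<pi>Pi: "\<pi> t k \<in> Pis k" if "t \<le> N" for t k
    using run_\<pi>[of t k] init(3) that by (cases "t = 0") (auto simp: is_arg_max_def)

  \<comment> \<open>Bounds by the constants of the problem\<close>
  have S: "subspace (S k)" "convex (S k)" "S k \<noteq> {}" for k
    using subspace_coord_space[of "J k"] by (auto simp: S_eq subspace_imp_convex dest: subspace_0)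
  have TS: "T k *v y \<in> S k" for k y
    using T_block[of _ k] by (simp add: S_eq coord_space_def matrix_vector_mult_def row_def vec_eq_iff)
  have Gconv: "convex_on (Pis k) (G k)" for k
    unfolding Pi_eq G_def by (rule convex_on_fenchel_conj) (rule S)+
  have norm_Pi: "norm v \<le> MPi" if "v \<in> Pis k" for v k
  proof -
    obtain L where "L-lipschitz_on (S k) (g k)" using g(2) by blast
    then have "bdd_above (norm ` Pis k)"
      using conj_dom_norm_le_lipschitz[OF S(1)] by (auto simp: Pi_eq intro!: bdd_aboveI2)
    then have "norm v \<le> (SUP v\<in>Pis k. norm v)" using that by (rule cSUP_upper2) simp
    also have "\<dots> \<le> MPi" unfolding MPi(1) by (intro Max_ge) auto
    finally show ?thesis .
  qed
  have T_norm: "norm (T k *v y) \<le> MT * norm y" for k y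
  proof -
    have "norm (T k *v y) \<le> onorm (\<lambda>y. T k *v y) * norm y"
      by (intro onorm matrix_vector_mul_bounded_linear)
    also have "\<dots> \<le> MT * norm y" unfolding MT(1) by (intro mult_right_mono Max_ge) auto
    finally show ?thesis .
  qed
  \<comment> \<open>Positivity of \<open>\<Omega>X\<close> makes the supremum under the root
    positive, so squaring recovers it. The bounds \<open>UP\<close> and \<open>UPi\<close> use the
    same fact.\<close>
  have UX: "half_sqdist (x 0) y \<le> \<Omega>X\<^sup>2" if "y \<in> X" for y
  proof -
    have "bdd_above (half_sqdist (x 0) ` X)"
      unfolding half_sqdist_def
      by (intro bounded_imp_bdd_above compact_imp_bounded compact_continuous_image continuous_intros X(3)) simp
    then have "half_sqdist (x 0) y \<le> (SUP y\<in>X. half_sqdist (x 0) y)" using that by (intro cSUP_upper)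
    also have "\<dots> = \<Omega>X\<^sup>2" using OmegaX by simp
    finally show ?thesis .
  qed
  have UP: "W (p 0) r \<le> \<Omega>P\<^sup>2" if "r \<in> P" for r
    using cSUP_upper[OF that OmegaP_fin] OmegaP by simp
  have UPi: "half_sqdist (\<pi> 0 k) v \<le> \<Omega>Pi\<^sup>2" if "v \<in> Pis k" for v k
  proof -
    \<comment> \<open>This crude bound only serves to make the supremum over \<open>Pis k\<close> a
      genuine upper bound.\<close>
    have "half_sqdist (\<pi> 0 k) v \<le> (2 * MPi)\<^sup>2 / 2" if "v \<in> Pis k" for v
      unfolding half_sqdist_def
      using norm_Pi[OF init(3)[of k]] norm_Pi[OF that] norm_triangle_ineq4[of "\<pi> 0 k" v]
      by (intro divide_right_mono power_mono) auto
    then have "bdd_above (half_sqdist (\<pi> 0 k) ` Pis k)" by (rule bdd_aboveI2)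
    then have "half_sqdist (\<pi> 0 k) v \<le> (SUP v\<in>Pis k. half_sqdist (\<pi> 0 k) v)"
      using that by (intro cSUP_upper)
    also have "\<dots> \<le> (MAX k. SUP v\<in>Pis k. half_sqdist (\<pi> 0 k) v)" by (intro Max_ge) auto
    also have "\<dots> = \<Omega>Pi\<^sup>2" using OmegaPi by simp
    finally show ?thesis .
  qed
  have pos: "\<sigma> > 0" "\<tau> > 0" "\<kappa> > 0"
    using OmegaX(2) OmegaP(2) OmegaPi(2) MT(2) MPi(2) Cp(2) by (auto simp: sigma tau \<kappa>_def)

  \<comment> \<open>Gap of the inner dual variables\<close>
  have dual_\<pi>: "(\<Sum>t=1..N. (T k *v x t) \<bullet> v - G k v - a t k) \<le> \<sigma> * \<Omega>Pi\<^sup>2 + MT\<^sup>2 / (2 * \<sigma>) * D"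
    if v: "v \<in> Pis k" for k v
  proof -
    have T_young: "(T k *v y) \<bullet> (u - w) \<le> \<sigma> * half_sqdist w u + MT\<^sup>2 / (2 * \<sigma>) * (norm y)\<^sup>2" for y u w
    proof -
      have "(T k *v y) \<bullet> (u - w) \<le> norm (T k *v y) * norm (u - w)" by (rule norm_cauchy_schwarz)
      also have "\<dots> \<le> MT * norm y * norm (u - w)" by (intro mult_right_mono T_norm) simp
      also have "\<dots> \<le> \<sigma> * ((norm (u - w))\<^sup>2 / 2) + MT\<^sup>2 / (2 * \<sigma>) * (norm y)\<^sup>2"
        by (rule young_bound) (rule pos)
      finally show ?thesis by (simp add: half_sqdist_def norm_minus_commute)
    qed
    have "(\<Sum>t=1..N. (T k *v x t) \<bullet> v - G k v - a t k)
        \<le> \<sigma> * half_sqdist (\<pi> 0 k) v + MT\<^sup>2 / (2 * \<sigma>) * D"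
      unfolding D_def
    \<comment> \<open>The proximal step sees \<open>x (t - 1) + d (t - 1)\<close>, from which
      \<open>x t\<close> differs by \<open>d t - d (t - 1)\<close>. Paired with
      \<open>v - \<pi> t k\<close>, the part with \<open>d t\<close> is \<open>A t\<close>, and the
      part with \<open>d (t - 1)\<close> is \<open>A (t - 1)\<close> up to the remainder
      \<open>R t\<close> between consecutive duals.\<close>
    proof (rule extrapolated_telescope[where B = "\<lambda>t. half_sqdist (\<pi> t k) v"
          and A = "\<lambda>t. (T k *v d t) \<bullet> (v - \<pi> t k)"
          and R = "\<lambda>t. (T k *v d (t - 1)) \<bullet> (\<pi> t k - \<pi> (t - 1) k)"
          and E = "\<lambda>t. half_sqdist (\<pi> (t - 1) k) (\<pi> t k)"])
      fix t assume t: "t \<in> {1..N}"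
      let ?y = "T k *v (x (t - 1) + d (t - 1))"
      have "convex_on (Pis k) (\<lambda>v. G k v + (- ?y) \<bullet> v)"
        by (intro convex_on_add_inner Gconv)
      then have "(G k (\<pi> t k) + (- ?y) \<bullet> \<pi> t k) - (G k v + (- ?y) \<bullet> v)
          \<le> \<sigma> * (half_sqdist (\<pi> (t - 1) k) v - half_sqdist (\<pi> t k) v - half_sqdist (\<pi> (t - 1) k) (\<pi> t k))"
        using run_\<pi>[OF t, of k] \<pi>Pi[of t k] t v
        by (intro half_sqdist_three_point) (auto simp: is_arg_max_linorder)
      moreover have "x t = x (t - 1) + d t" by (simp add: d_def)
      ultimately show "(T k *v x t) \<bullet> v - G k v - a t k
          \<le> \<sigma> * (half_sqdist (\<pi> (t - 1) k) v - half_sqdist (\<pi> t k) v - half_sqdist (\<pi> (t - 1) k) (\<pi> t k))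
            + (T k *v d t) \<bullet> (v - \<pi> t k) - (T k *v d (t - 1)) \<bullet> (v - \<pi> (t - 1) k)
            + (T k *v d (t - 1)) \<bullet> (\<pi> t k - \<pi> (t - 1) k)"
        by (simp add: a_def matrix_vector_right_distrib inner_simps)
    next
      show "(T k *v d N) \<bullet> (v - \<pi> N k)
          \<le> \<sigma> * half_sqdist (\<pi> N k) v + MT\<^sup>2 / (2 * \<sigma>) * (norm (d N))\<^sup>2"
        by (rule T_young)
    qed (use T_young in \<open>auto simp: d0\<close>)
    also have "\<dots> \<le> \<sigma> * \<Omega>Pi\<^sup>2 + MT\<^sup>2 / (2 * \<sigma>) * D"
      using UPi[OF v] pos by simp
    finally show ?thesis .
  qed

  \<comment> \<open>Gap of the probability weights\<close>
  have W_young: "(r - p t) \<bullet> q s \<le> \<tau> * W (p t) r + \<kappa>\<^sup>2 / (2 * \<tau>) * (norm (d s))\<^sup>2"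
    if r: "r \<in> P" and st: "s \<le> N" "t \<le> N" for r s t
  proof -
    let ?\<delta> = "\<chi> k. \<bar>(r - p t) $ k\<bar>" and ?n = "\<chi> k. norm (\<pi> s k)"
    have n0: "normW w \<ge> 0" for w using normW(1) by (simp add: is_norm_def)
    \<comment> \<open>Absolute values are taken coordinatewise before duality is applied, because
      \<open>Cp\<close> controls the dual norm of the vector of norms \<open>?n\<close>.
      Absoluteness of \<open>normW\<close> afterwards turns \<open>?\<delta>\<close> back into
      \<open>r - p t\<close>.\<close>
    have "(r - p t) \<bullet> q s \<le> (\<Sum>k\<in>UNIV. (MT * norm (d s)) * (?n $ k * ?\<delta> $ k))"
      unfolding inner_vec_def
    proof (rule sum_mono)
      fix k
      have "\<bar>(T k *v d s) \<bullet> \<pi> s k\<bar> \<le> norm (T k *v d s) * norm (\<pi> s k)"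
        by (rule Cauchy_Schwarz_ineq2)
      also have "\<dots> \<le> MT * norm (d s) * norm (\<pi> s k)" by (intro mult_right_mono T_norm) simp
      finally have "\<bar>(r - p t) $ k\<bar> * \<bar>(T k *v d s) \<bullet> \<pi> s k\<bar>
          \<le> \<bar>(r - p t) $ k\<bar> * (MT * norm (d s) * norm (\<pi> s k))" by (rule mult_left_mono) simp
      moreover have "(r - p t) $ k \<bullet> q s $ k \<le> \<bar>(r - p t) $ k\<bar> * \<bar>(T k *v d s) \<bullet> \<pi> s k\<bar>"
        by (simp add: q_def flip: abs_mult)
      ultimately show "(r - p t) $ k \<bullet> q s $ k \<le> (MT * norm (d s)) * (?n $ k * ?\<delta> $ k)"
        by (simp add: algebra_simps)
    qed
    also have "\<dots> = MT * norm (d s) * (?n \<bullet> ?\<delta>)" by (simp add: inner_vec_def sum_distrib_left)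
    also have "\<dots> \<le> MT * norm (d s) * (dual_norm normW ?n * normW ?\<delta>)"
      using MT(2) by (intro mult_left_mono inner_le_dual_norm normW) simp
    also have "\<dots> \<le> MT * norm (d s) * (Cp * MPi * normW ?\<delta>)"
    proof (intro mult_left_mono mult_right_mono n0)
      have "(MAX k. norm (\<pi> s k)) \<le> MPi" using \<pi>Pi[OF st(1)] norm_Pi by auto
      then have "Cp * (MAX k. norm (\<pi> s k)) \<le> Cp * MPi" using Cp(2) by simp
      with Cp(1)[of "\<pi> s", OF \<pi>Pi[OF st(1)]] show "dual_norm normW ?n \<le> Cp * MPi" by simp
    qed (use MT(2) in simp)
    also have "normW ?\<delta> = normW (r - p t)" using normW(2) unfolding absolute_norm_def by blast
    also have "MT * norm (d s) * (Cp * MPi * normW (r - p t)) = \<kappa> * norm (d s) * normW (r - p t)"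
      by (simp add: \<kappa>_def)
    also have "\<dots> \<le> \<tau> * ((normW (r - p t))\<^sup>2 / 2) + \<kappa>\<^sup>2 / (2 * \<tau>) * (norm (d s))\<^sup>2"
      by (rule young_bound) (rule pos)
    also have "normW (r - p t) = normW (p t - r)"
    proof -
      have "normW (- (p t - r)) = normW (p t - r)"
        using normW(1) unfolding is_norm_def by (metis abs_minus_cancel abs_one mult_1 scaleR_minus1_left)
      then show ?thesis by simp
    qed
    also have "\<tau> * ((normW (p t - r))\<^sup>2 / 2) \<le> \<tau> * W (p t) r"
      using bregman_ge_strongly_convex[where grad = grad, OF omega grad[OF st(2)] P(2) pP[OF st(2)] r] pos
      by (simp add: W_eq)
    finally show ?thesis by simp
  qed
  have dual_p: "(\<Sum>t=1..N. (\<Sum>k\<in>UNIV. (r $ k - p t $ k) * a t k) - \<phi> r + \<phi> (p t))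
      \<le> \<tau> * \<Omega>P\<^sup>2 + \<kappa>\<^sup>2 / (2 * \<tau>) * D" if r: "r \<in> P" for r
  proof -
    have "(\<Sum>t=1..N. (\<Sum>k\<in>UNIV. (r $ k - p t $ k) * a t k) - \<phi> r + \<phi> (p t))
        \<le> \<tau> * W (p 0) r + \<kappa>\<^sup>2 / (2 * \<tau>) * D"
      unfolding D_def
    proof (rule extrapolated_telescope[where B = "\<lambda>t. W (p t) r"
          and A = "\<lambda>t. (r - p t) \<bullet> q t"
          and R = "\<lambda>t. (p t - p (t - 1)) \<bullet> q (t - 1)"
          and E = "\<lambda>t. W (p (t - 1)) (p t)"])
      fix t assume t: "t \<in> {1..N}"
      let ?ft = "(\<chi> k. ft t k)"
      have "convex_on P (\<lambda>r. \<phi> r + (- ?ft) \<bullet> r)"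
        using phi by (intro convex_on_add_inner) (simp add: closed_convex_on_def)
      then have "(\<phi> (p t) + (- ?ft) \<bullet> p t) - (\<phi> r + (- ?ft) \<bullet> r)
          \<le> \<tau> * (W (p (t - 1)) r - W (p t) r - W (p (t - 1)) (p t))"
        unfolding W_eq using run_p[OF t] pP[of t] t r grad[of t]
        by (intro bregman_three_point) (auto simp: is_arg_max_linorder W_eq inner_vec_def mult.commute sum_negf)
      moreover have "(\<Sum>k\<in>UNIV. (r $ k - p t $ k) * a t k) = (r - p t) \<bullet> (\<chi> k. a t k)"
        by (simp add: inner_vec_def)
      \<comment> \<open>\<open>p t\<close> is chosen before \<open>x t\<close> is known, so
        \<open>ft\<close> only predicts \<open>a\<close>, with error \<open>q t - q (t - 1)\<close>.
        Splitting \<open>r - p t\<close> at \<open>p (t - 1)\<close> in the second term produces the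
        telescoping part and \<open>R t\<close>.\<close>
      moreover have "(\<chi> k. a t k) = ?ft + q t - q (t - 1)"
      proof -
        have "T k *v x t = T k *v x (t - 1) + T k *v d t" for k
          by (simp add: d_def flip: matrix_vector_right_distrib)
        then show ?thesis
          by (intro vec_eq_iff[THEN iffD2] allI) (simp add: a_def ft_def q_def inner_simps)
      qed
      ultimately show "(\<Sum>k\<in>UNIV. (r $ k - p t $ k) * a t k) - \<phi> r + \<phi> (p t)
          \<le> \<tau> * (W (p (t - 1)) r - W (p t) r - W (p (t - 1)) (p t))
            + (r - p t) \<bullet> q t - (r - p (t - 1)) \<bullet> q (t - 1) + (p t - p (t - 1)) \<bullet> q (t - 1)"
        by (simp add: inner_simps inner_commute)
    next
      show "(r - p 0) \<bullet> q 0 = 0" by (simp add: q_def d0 inner_vec_def)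
    qed (use W_young r pP in \<open>auto simp: d0\<close>)
    also have "\<dots> \<le> \<tau> * \<Omega>P\<^sup>2 + \<kappa>\<^sup>2 / (2 * \<tau>) * D"
      using UP[OF r] pos by simp
    finally show ?thesis .
  qed

  \<comment> \<open>Gap of the primal variable\<close>
  define L where "L = (\<lambda>t y. f0 y + (\<Sum>k\<in>UNIV. p t $ k * ((T k *v y) \<bullet> \<pi> t k)))"
  have eta0: "\<eta> > 0" using OmegaX(2) OmegaP(2) OmegaPi(2) MT(2) MPi(2) Cp(2)
    unfolding eta by (intro add_pos_pos) auto
  \<comment> \<open>The primal step uses the current \<open>p t\<close> and \<open>\<pi> t\<close>,
    so no coupling error arises, and the whole negative term in \<open>D\<close> remains to pay for
    both dual bounds.\<close>
  have primal: "(\<Sum>t=1..N. L t (x t) - L t y) \<le> \<eta> * \<Omega>X\<^sup>2 - \<eta> / 2 * D" if y: "y \<in> X" for y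
  proof -
    have step: "L t (x t) - L t y \<le> \<eta> * (half_sqdist (x (t - 1)) y - half_sqdist (x t) y
        - (norm (d t))\<^sup>2 / 2)" if t: "t \<in> {1..N}" for t
    proof -
      \<comment> \<open>Moving each \<open>T k\<close> to the dual side exhibits the coupling as
        linear in \<open>y\<close>.\<close>
      have "L t = (\<lambda>y. f0 y + (\<Sum>k\<in>UNIV. p t $ k *\<^sub>R (\<pi> t k v* T k)) \<bullet> y)"
        unfolding L_def inner_sum_left inner_scaleR_left dot_lmul_matrix by (simp add: inner_commute)
      moreover have "convex_on X (\<lambda>y. f0 y + (\<Sum>k\<in>UNIV. p t $ k *\<^sub>R (\<pi> t k v* T k)) \<bullet> y)"
        using f0(1) by (intro convex_on_add_inner) (simp add: closed_convex_on_def)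
      ultimately have "convex_on X (L t)" by simp
      then have "L t (x t) - L t y \<le> \<eta> * (half_sqdist (x (t - 1)) y - half_sqdist (x t) y
          - half_sqdist (x (t - 1)) (x t))"
        using run_x[OF t] xX[of t] t y
        by (intro half_sqdist_three_point) (auto simp: is_arg_min_linorder L_def)
      then show ?thesis by (simp add: half_sqdist_def d_def norm_minus_commute)
    qed
    have "n \<le> N \<Longrightarrow> (\<Sum>t=1..n. L t (x t) - L t y)
        \<le> \<eta> * (half_sqdist (x 0) y - half_sqdist (x n) y) - \<eta> / 2 * (\<Sum>t=1..n. (norm (d t))\<^sup>2)" for n
    proof (induction n)
      case (Suc n)
      then show ?case using step[of "Suc n"] by (simp add: algebra_simps)
    qed simp
    from this[of N] have "(\<Sum>t=1..N. L t (x t) - L t y)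
        \<le> \<eta> * (half_sqdist (x 0) y - half_sqdist (x N) y) - \<eta> / 2 * D" by (simp add: D_def)
    moreover have "\<eta> * (half_sqdist (x 0) y - half_sqdist (x N) y) \<le> \<eta> * \<Omega>X\<^sup>2"
      using UX[OF y] eta0 by (intro mult_left_mono) (auto simp: half_sqdist_def add_increasing2 diff_le_eq)
    ultimately show ?thesis by simp
  qed

  \<comment> \<open>The objective as a supremum\<close>
  have phi_bdd: "bdd_below (\<phi> ` P)"
    using phi P(3) closed_epigraph_bdd_below by (auto simp: closed_convex_on_def)
  \<comment> \<open>The real \<open>SUP\<close> needs an upper bound: the weights lie between 0 and
    1, and \<open>\<phi>\<close> is bounded below on \<open>P\<close>.\<close>
  have f_ge: "f0 y + ((\<Sum>k\<in>UNIV. r $ k * g k (T k *v y)) - \<phi> r) \<le> f y" if r: "r \<in> P" for r y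
  proof -
    obtain c where c: "\<And>r. r \<in> P \<Longrightarrow> c \<le> \<phi> r" using phi_bdd unfolding bdd_below_def by blast
    have "(\<Sum>k\<in>UNIV. r $ k * g k (T k *v y)) - \<phi> r \<le> (\<Sum>k\<in>UNIV. \<bar>g k (T k *v y)\<bar>) - c"
      if r: "r \<in> P" for r
    proof (intro diff_mono c r sum_mono)
      fix k
      have "0 \<le> r $ k" "(\<Sum>k\<in>UNIV. r $ k) = 1" using P_prob[OF r] by auto
      moreover from this have "r $ k \<le> 1"
        using P_prob[OF r] by (metis finite_class.finite_UNIV member_le_sum UNIV_I)
      ultimately have "r $ k * \<bar>g k (T k *v y)\<bar> \<le> 1 * \<bar>g k (T k *v y)\<bar>"
        by (intro mult_right_mono) auto
      moreover have "r $ k * g k (T k *v y) \<le> r $ k * \<bar>g k (T k *v y)\<bar>"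
        using \<open>0 \<le> r $ k\<close> by (intro mult_left_mono) auto
      ultimately show "r $ k * g k (T k *v y) \<le> \<bar>g k (T k *v y)\<bar>" by simp
    qed
    then have "bdd_above ((\<lambda>r. (\<Sum>k\<in>UNIV. r $ k * g k (T k *v y)) - \<phi> r) ` P)"
      by (rule bdd_aboveI2)
    from cSUP_upper[OF r this] show ?thesis by (simp add: f_eq risk_objective_def)
  qed

  \<comment> \<open>Summation of the gaps and averaging\<close>
  let ?xb = "(1 / real N) *\<^sub>R (\<Sum>t=1..N. x t)"
  let ?B = "2 * \<Omega>X * MT * (\<Omega>Pi + Cp * MPi * \<Omega>P)"
  have xoptX: "xopt \<in> X" using xopt by (simp add: is_arg_min_def)
  have avg: "real N * f0 ?xb \<le> (\<Sum>t=1..N. f0 (x t))"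
  proof -
    have "f0 (\<Sum>t=1..N. (1 / real N) *\<^sub>R x t) \<le> (\<Sum>t=1..N. 1 / real N * f0 (x t))"
      using f0(1) N xX by (intro convex_on_sum) (auto simp: closed_convex_on_def)
    then have "f0 ?xb \<le> (\<Sum>t=1..N. f0 (x t)) / real N"
      by (simp add: scaleR_sum_right sum_divide_distrib)
    then show ?thesis using N by (simp add: field_simps)
  qed
  \<comment> \<open>The comparison duals are taken at the averaged point, so they are fixed in
    \<open>t\<close> and \<open>dual_\<pi>\<close> applies to them.\<close>
  obtain v where v: "\<And>k. v k \<in> Pis k" "\<And>k. g k (T k *v ?xb) \<le> (T k *v ?xb) \<bullet> v k - G k (v k)"
  proof -
    have "\<exists>u. u \<in> Pis k \<and> g k (T k *v ?xb) \<le> (T k *v ?xb) \<bullet> u - G k u" for k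
      using fenchel_biconjugate_attained[of "J k" "g k" "T k *v ?xb"] g(1)[of k] TS[of k ?xb]
      unfolding Pi_eq G_def S_eq by blast
    then show ?thesis using that by metis
  qed
  have bound: "f0 ?xb + ((\<Sum>k\<in>UNIV. r $ k * g k (T k *v ?xb)) - \<phi> r) \<le> f xopt + ?B / real N"
    if r: "r \<in> P" for r
  proof -
    have r0: "0 \<le> r $ k" and r1: "(\<Sum>k\<in>UNIV. r $ k) = 1" for k using P_prob[OF r] by auto
    define A where "A = \<sigma> * \<Omega>Pi\<^sup>2 + MT\<^sup>2 / (2 * \<sigma>) * D"
    define val where "val = (\<lambda>k y. (T k *v y) \<bullet> v k - G k (v k))"
    \<comment> \<open>The weights sum to 1, so combining the blockwise bounds costs no factor for
      the number of blocks.\<close>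
    have "(\<Sum>k\<in>UNIV. r $ k * (\<Sum>t=1..N. val k (x t) - a t k)) \<le> (\<Sum>k\<in>UNIV. r $ k * A)"
      unfolding A_def val_def by (intro sum_mono mult_left_mono dual_\<pi> v r0)
    also have "\<dots> = A" by (simp add: r1 flip: sum_distrib_right)
    finally have ub_\<pi>: "(\<Sum>t=1..N. \<Sum>k\<in>UNIV. r $ k * (val k (x t) - a t k)) \<le> A"
      by (subst sum.swap) (simp add: sum_distrib_left)
    \<comment> \<open>The Fenchel-Young inequality replaces the conjugate terms by
      \<open>g k\<close>, and \<open>p t\<close> competes in the supremum defining
      \<open>f xopt\<close>.\<close>
    have lower: "L t xopt - (\<Sum>k\<in>UNIV. p t $ k * G k (\<pi> t k)) - \<phi> (p t) \<le> f xopt"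
      if t: "t \<in> {1..N}" for t
    proof -
      have "(T k *v xopt) \<bullet> \<pi> t k - g k (T k *v xopt) \<le> G k (\<pi> t k)" for k
        using \<pi>Pi[of t k] t TS[of k xopt] unfolding G_def Pi_eq by (intro fenchel_conj_upper) auto
      then have "(\<Sum>k\<in>UNIV. p t $ k * ((T k *v xopt) \<bullet> \<pi> t k - G k (\<pi> t k)))
          \<le> (\<Sum>k\<in>UNIV. p t $ k * g k (T k *v xopt))"
        using P_prob[OF pP[of t]] t by (intro sum_mono mult_left_mono) (auto simp: diff_le_eq add.commute)
      with f_ge[OF pP[of t], of xopt] t show ?thesis
        by (simp add: L_def right_diff_distrib sum_subtractf)
    qed
    \<comment> \<open>The passage from the Lagrangian at \<open>(x t, r, v)\<close> to that at
      \<open>(xopt, p t, \<pi> t)\<close> changes one argument at a time: first \<open>v\<close>,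
      then \<open>r\<close>, then \<open>x t\<close>.\<close>
    have "(\<Sum>t=1..N. f0 (x t) + (\<Sum>k\<in>UNIV. r $ k * val k (x t)) - \<phi> r)
        = (\<Sum>t=1..N. \<Sum>k\<in>UNIV. r $ k * (val k (x t) - a t k))
          + (\<Sum>t=1..N. (\<Sum>k\<in>UNIV. (r $ k - p t $ k) * a t k) - \<phi> r + \<phi> (p t))
          + (\<Sum>t=1..N. L t (x t) - L t xopt)
          + (\<Sum>t=1..N. L t xopt - (\<Sum>k\<in>UNIV. p t $ k * G k (\<pi> t k)) - \<phi> (p t))"
      unfolding sum.distrib[symmetric]
      by (intro sum.cong refl)
        (simp add: L_def a_def left_diff_distrib right_diff_distrib sum_subtractf)
    also have "\<dots> \<le> A + (\<tau> * \<Omega>P\<^sup>2 + \<kappa>\<^sup>2 / (2 * \<tau>) * D) + (\<eta> * \<Omega>X\<^sup>2 - \<eta> / 2 * D) + (\<Sum>t=1..N. f xopt)"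
      by (intro add_mono ub_\<pi> dual_p r primal xoptX sum_mono lower)
    also have "\<dots> = ?B + real N * f xopt"
    proof -
      \<comment> \<open>The two dual coefficients are
        \<open>MT * \<Omega>Pi / (2 * \<Omega>X)\<close> and
        \<open>\<kappa> * \<Omega>P / (2 * \<Omega>X)\<close>, the halves of the summands of
        \<open>\<eta>\<close>, so \<open>D\<close> cancels. The dual distance terms likewise add up
        to \<open>\<eta> * \<Omega>X\<^sup>2\<close>, which explains the factor 2 in
        \<open>?B\<close>.\<close>
      have "MT\<^sup>2 / (2 * \<sigma>) + \<kappa>\<^sup>2 / (2 * \<tau>) = \<eta> / 2"
        using OmegaX(2) OmegaP(2) OmegaPi(2) MT(2) MPi(2) Cp(2)
        by (simp add: sigma tau eta \<kappa>_def field_simps power2_eq_square)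
      then have "MT\<^sup>2 / (2 * \<sigma>) * D + \<kappa>\<^sup>2 / (2 * \<tau>) * D = \<eta> / 2 * D"
        by (metis distrib_right)
      moreover have "\<sigma> * \<Omega>Pi\<^sup>2 + \<tau> * \<Omega>P\<^sup>2 + \<eta> * \<Omega>X\<^sup>2 = ?B"
        using OmegaX(2) OmegaP(2) OmegaPi(2)
        by (simp add: sigma tau eta field_simps power2_eq_square)
      moreover have "(\<Sum>t=1..N. f xopt) = real N * f xopt" by simp
      ultimately show ?thesis unfolding A_def by linarith
    qed
    finally have main: "(\<Sum>t=1..N. f0 (x t) + (\<Sum>k\<in>UNIV. r $ k * val k (x t)) - \<phi> r)
        \<le> ?B + real N * f xopt" .
    \<comment> \<open>With \<open>v k\<close> fixed, \<open>val k\<close> is affine in the point, so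
      averaging is an equality here; convexity enters only through \<open>f0\<close>.\<close>
    have val_avg: "(\<Sum>t=1..N. val k (x t)) = real N * val k ?xb" for k
    proof -
      have "(\<Sum>t=1..N. x t) = real N *\<^sub>R ?xb" using N by simp
      then have "(\<Sum>t=1..N. T k *v x t) = real N *\<^sub>R (T k *v ?xb)"
        by (metis matrix_vector_mult_scaleR vec.sum matrix_vector_mul_linear linear_sum)
      then have "(\<Sum>t=1..N. (T k *v x t) \<bullet> v k) = real N * ((T k *v ?xb) \<bullet> v k)"
        by (metis inner_sum_left inner_scaleR_left)
      then show ?thesis by (simp only: val_def sum_subtractf) (simp add: right_diff_distrib)
    qed
    have "real N * (f0 ?xb + ((\<Sum>k\<in>UNIV. r $ k * g k (T k *v ?xb)) - \<phi> r))
        \<le> real N * (f0 ?xb + ((\<Sum>k\<in>UNIV. r $ k * val k ?xb) - \<phi> r))"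
      using v(2) unfolding val_def by (intro mult_left_mono add_left_mono diff_right_mono sum_mono r0) auto
    also have "\<dots> = real N * f0 ?xb + (\<Sum>t=1..N. (\<Sum>k\<in>UNIV. r $ k * val k (x t)) - \<phi> r)"
    proof -
      have "(\<Sum>t=1..N. \<Sum>k\<in>UNIV. r $ k * val k (x t)) = real N * (\<Sum>k\<in>UNIV. r $ k * val k ?xb)"
        by (subst sum.swap) (simp only: sum_distrib_left[symmetric] val_avg, simp add: sum_distrib_left mult.left_commute)
      then show ?thesis by (simp only: sum_subtractf) (simp add: algebra_simps)
    qed
    also have "\<dots> \<le> ?B + real N * f xopt"
      using main avg by (simp add: sum.distrib sum_subtractf)
    finally show ?thesis using N by (simp add: field_simps)
  qed
  have "f ?xb \<le> f xopt + ?B / real N"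
  proof -
    have "(SUP r\<in>P. (\<Sum>k\<in>UNIV. r $ k * g k (T k *v ?xb)) - \<phi> r) \<le> f xopt + ?B / real N - f0 ?xb"
      using bound by (intro cSUP_least P(1)) (simp add: algebra_simps)
    then show ?thesis by (simp add: f_eq risk_objective_def)
  qed
  then show ?thesis by simp
qed

end
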